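(* Let $f:\mathbb{R}^n\to\mathbb{R}$ be $\mathbf M$-smooth, $\mathbf M\succ0$, and $\mu$-strongly convex, $\mu>0$, with minimizer $x^*$. Suppose that in each iteration of SEGA the sketch is a standard unit basis vector $e_i$, sampled with probability $p_i=\mathbf M_{ii}/\mathrm{Trace}(\mathbf M)$. If $\alpha=\frac{0.232}{\mathrm{Trace}(\mathbf M)}$ and $\sigma=\frac{0.061}{\mathrm{Trace}(\mathbf M)}$, then, with $\Psi^k=f(x^k)-f(x^* )+\sigma\|h^k\|^2_{\mathrm{Diag}(p)^{-1}}$, for all $k\geq 0$ $$\mathbb{E}[\Psi^k]\le\left(1-\frac{0.117\,\mu}{\mathrm{Trace}(\mathbf M)}\right)^k\Psi^0 .$$
   Context: $\nabla f$ is the usual gradient; $\|x\|_{\mathbf W}^2=x^\top\mathbf Wx$. $f$ is $\mathbf M$-smooth if it is differentiable and $f(x)\le f(y)+\langle\nabla f(y),x-y\rangle+\frac12\|x-y\|_{\mathbf M}^2$ for all $x,y$; $\mu$-strongly convex if $f(x)\ge f(y)+\langle\nabla f(y),x-y\rangle+\frac\mu2\|x-y\|_2^2$ for all $x,y$. SEGA with single-coordinate sketches (no regularizer), started at arbitrary $x^0,h^0\in\mathbb{R}^n$: for $k=0,1,2,\dots$ draw $i=i_k$ independently with probabilities $p_i$ and set $g^k=h^k+\frac1{p_i}e_i^\top(\nabla f(x^k)-h^k)\,e_i$, $\;x^{k+1}=x^k-\alpha g^k$, $\;h^{k+1}=h^k+e_i^\top(\nabla f(x^k)-h^k)\,e_i$.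 *)

theory Defs
  imports "HOL-Probability.Probability"
begin

text \<open>Meaningful only where \<open>f\<close> is differentiable; the value elsewhere is unspecified.\<close>
definition grad :: "('a::real_inner \<Rightarrow> real) \<Rightarrow> 'a \<Rightarrow> 'a" where
  "grad f x = (THE D. GDERIV f x :> D)"

definition wnorm2 :: "real^'n^'n \<Rightarrow> real^'n \<Rightarrow> real" where
  "wnorm2 W x = x \<bullet> (W *v x)"

definition diag_mat :: "real^'n \<Rightarrow> real^'n^'n" where
  "diag_mat p = (\<chi> i j. if i = j then p $ i else 0)"

definition pos_def :: "real^'n^'n \<Rightarrow> bool" where
  "pos_def W \<longleftrightarrow> transpose W = W \<and> (\<forall>x. x \<noteq> 0 \<longrightarrow> x \<bullet> (W *v x) > 0)"

definition M_smooth :: "real^'n^'n \<Rightarrow> (real^'n \<Rightarrow> real) \<Rightarrow> bool" where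
  "M_smooth M f \<longleftrightarrow> (\<forall>x. f differentiable (at x)) \<and>
     (\<forall>x y. f x \<le> f y + grad f y \<bullet> (x - y) + 1/2 * wnorm2 M (x - y))"

text \<open>As for the gradient, only used for differentiable \<open>f\<close>.\<close>
definition strongly_convex :: "real \<Rightarrow> (real^'n \<Rightarrow> real) \<Rightarrow> bool" where
  "strongly_convex \<mu> f \<longleftrightarrow>
     (\<forall>x y. f x \<ge> f y + grad f y \<bullet> (x - y) + \<mu>/2 * (norm (x - y))\<^sup>2)"

text \<open>One step of the iteration on the state \<open>(x\<^sup>k, h\<^sup>k)\<close> when coordinate \<open>i\<close> is drawn;
  \<open>axis i 1\<close> is the unit vector \<open>e\<^sub>i\<close>.\<close>
definition sega_step ::
  "(real^'n \<Rightarrow> real) \<Rightarrow> real^'n \<Rightarrow> real \<Rightarrow> 'n \<Rightarrow> (real^'n) \<times> (real^'n) \<Rightarrow> (real^'n) \<times> (real^'n)" where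
  "sega_step f p \<alpha> i = (\<lambda>(x, h).
     let d = axis i 1 \<bullet> (grad f x - h);
         g = h + (1 / p $ i * d) *\<^sub>R axis i 1
     in (x - \<alpha> *\<^sub>R g, h + d *\<^sub>R axis i 1))"

text \<open>The state \<open>(x\<^sup>k, h\<^sup>k)\<close> produced by the sequence of draws \<open>is\<close>.\<close>
primrec sega ::
  "(real^'n \<Rightarrow> real) \<Rightarrow> real^'n \<Rightarrow> real \<Rightarrow> real^'n \<Rightarrow> real^'n \<Rightarrow> (nat \<Rightarrow> 'n) \<Rightarrow> nat
     \<Rightarrow> (real^'n) \<times> (real^'n)" where
  "sega f p \<alpha> x0 h0 is 0 = (x0, h0)"
| "sega f p \<alpha> x0 h0 is (Suc k) = sega_step f p \<alpha> (is k) (sega f p \<alpha> x0 h0 is k)"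

definition sega_lyapunov ::
  "(real^'n \<Rightarrow> real) \<Rightarrow> real^'n \<Rightarrow> real^'n \<Rightarrow> real \<Rightarrow> (real^'n) \<times> (real^'n) \<Rightarrow> real" where
  "sega_lyapunov f xstar p \<sigma> = (\<lambda>(x, h).
     f x - f xstar + \<sigma> * wnorm2 (matrix_inv (diag_mat p)) h)"

end

theory Submission
  imports Defs
begin

text \<open>
  Write \<open>T = trace M\<close>, \<open>G = grad f x\<close>, and \<open>g\<close> for the estimator of \<open>G\<close> formed in one step from the
  state \<open>(x, h)\<close>. The heart of the matter is that, for every fixed state, the mean of the Lyapunov
  function \<open>\<Psi>\<close> over the coordinate drawn is at most \<open>(1 - 0.117 \<mu> / T) \<Psi>(x, h)\<close>.

  The estimator is unbiased, so smoothness bounds the mean of \<open>f\<close> at the new point by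
  \<open>f x - \<alpha> |G|\<^sup>2 + \<alpha>\<^sup>2 E |g|\<^sub>M\<^sup>2 / 2\<close>. Sampling proportionally to the diagonal of \<open>M\<close> gives exactly
  \<open>E |g|\<^sub>M\<^sup>2 = |G|\<^sub>M\<^sup>2 - |G - h|\<^sub>M\<^sup>2 + T |G - h|\<^sup>2\<close> (\<open>coordinate_estimator_second_moment\<close>), which is at most
  \<open>3 T |G|\<^sup>2 + 2 T |h|\<^sup>2\<close> because \<open>|G - h|\<^sup>2 \<le> 2 |G|\<^sup>2 + 2 |h|\<^sup>2\<close> and the form of
  \<open>M\<close> is nonnegative and bounded by \<open>T\<close> times the Euclidean one
  (\<open>pos_def_wnorm2_le_trace\<close>). The error caused by \<open>h\<close> is what the second part of \<open>\<Psi>\<close> absorbs: the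
  weight \<open>1 / p\<^sub>j\<close> cancels against the probability of refreshing \<open>h\<^sub>j\<close>, so the mean of the weighted
  norm changes by exactly \<open>|G|\<^sup>2 - |h|\<^sup>2\<close> (\<open>coordinate_update_mean_weighted_norm\<close>).

  Altogether \<open>\<Psi>\<close> loses at least fixed multiples of \<open>|G|\<^sup>2 / T\<close> and \<open>|h|\<^sup>2 / T\<close> on average
  (\<open>sega_expected_decrease\<close>). Strong convexity gives \<open>|G|\<^sup>2 \<ge> 2 \<mu> (f x - f xstar)\<close>, and together with
  smoothness \<open>\<mu> \<le> M\<^sub>j\<^sub>j = T p\<^sub>j\<close>, hence \<open>|h|\<^sup>2\<close> is at least \<open>\<mu> / T\<close> times the weighted norm of \<open>h\<close>. So
  the loss is at least a multiple of \<open>\<Psi>\<close>, and \<open>\<alpha>\<close> and \<open>\<sigma>\<close> are chosen such that the factor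
  \<open>0.117 \<mu> / T\<close> is reached (\<open>sega_expected_contraction\<close>).

  The state before a draw is a function of the earlier draws, of which the new one is independent.
  Hence the bound for fixed states may be averaged over the past (\<open>expectation_next_draw\<close>), and the
  claim follows by induction on the number of steps.
\<close>

section \<open>Quadratic forms along coordinates\<close>

lemma wnorm2_uminus: "wnorm2 M (- x) = wnorm2 M x"
  by (simp add: wnorm2_def matrix_vector_mult_def inner_vec_def sum_negf sum_distrib_left)

lemma wnorm2_scaleR: "wnorm2 M (c *\<^sub>R x) = c\<^sup>2 * wnorm2 M x"
  by (simp add: wnorm2_def matrix_vector_mult_scaleR power2_eq_square)

lemma symmetric_matrix_inner_commute:
  fixes M :: "real^'n^'n"
  assumes "transpose M = M"
  shows "x \<bullet> (M *v y) = y \<bullet> (M *v x)"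
  by (metis assms dot_lmul_matrix inner_commute transpose_matrix_vector)

lemma wnorm2_add:
  fixes M :: "real^'n^'n"
  assumes "transpose M = M"
  shows "wnorm2 M (x + y) = wnorm2 M x + 2 * (y \<bullet> (M *v x)) + wnorm2 M y"
  using symmetric_matrix_inner_commute[OF assms, of x y]
  by (simp add: wnorm2_def matrix_vector_right_distrib inner_add_left inner_add_right)

lemma wnorm2_axis: "wnorm2 M (axis j 1) = M $ j $ j"
  by (simp add: wnorm2_def inner_axis' matrix_vector_mult_basis column_def)

lemma wnorm2_add_axis:
  fixes M :: "real^'n^'n"
  assumes "transpose M = M"
  shows "wnorm2 M (x + c *\<^sub>R axis j 1) = wnorm2 M x + 2 * c * (M *v x) $ j + c\<^sup>2 * M $ j $ j"
  by (simp add: wnorm2_add[OF assms] wnorm2_scaleR wnorm2_axis inner_axis')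

lemma pos_def_wnorm2_nonneg: "pos_def M \<Longrightarrow> 0 \<le> wnorm2 M x"
  by (cases "x = 0") (auto simp: pos_def_def wnorm2_def intro: less_imp_le)

lemma pos_def_diag_pos: "pos_def M \<Longrightarrow> 0 < M $ j $ j"
  by (metis pos_def_def wnorm2_axis wnorm2_def axis_eq_0_iff zero_neq_one)

lemma pos_def_trace_pos: "pos_def M \<Longrightarrow> 0 < trace M"
  unfolding trace_def by (intro sum_pos) (auto simp: pos_def_diag_pos)

lemma pos_def_diag_le_trace: "pos_def M \<Longrightarrow> M $ j $ j \<le> trace M"
  unfolding trace_def by (intro member_le_sum) (auto intro: less_imp_le pos_def_diag_pos)

text \<open>Positivity of the form at \<open>v\<^sub>b e\<^sub>a - v\<^sub>a e\<^sub>b\<close> bounds every entry \<open>v\<^sub>a M\<^sub>a\<^sub>b v\<^sub>b\<close> by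
  the mean of \<open>v\<^sub>b\<^sup>2 M\<^sub>a\<^sub>a\<close> and \<open>v\<^sub>a\<^sup>2 M\<^sub>b\<^sub>b\<close>; summing over \<open>a, b\<close> gives the trace
  bound.\<close>

lemma pos_def_wnorm2_le_trace:
  fixes M :: "real^'n^'n"
  assumes "pos_def M"
  shows "wnorm2 M v \<le> trace M * (v \<bullet> v)"
proof -
  have sym: "transpose M = M"
    using assms by (simp add: pos_def_def)
  have entry: "v $ a * (M $ a $ b * v $ b) \<le> (v $ b * v $ b * M $ a $ a + v $ a * v $ a * M $ b $ b) / 2"
    for a b
  proof -
    have ba: "M $ b $ a = M $ a $ b"
      by (metis sym transpose_def vec_lambda_beta)
    have "0 \<le> wnorm2 M (v $ b *\<^sub>R axis a 1 + (- v $ a) *\<^sub>R axis b 1)"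
      by (rule pos_def_wnorm2_nonneg[OF assms])
    also have "\<dots> = v $ b * v $ b * M $ a $ a + v $ a * v $ a * M $ b $ b
        - 2 * (v $ a * (M $ a $ b * v $ b))"
      unfolding wnorm2_add_axis[OF sym]
      by (simp add: wnorm2_scaleR wnorm2_axis matrix_vector_mult_scaleR
          matrix_vector_mult_basis column_def ba power2_eq_square)
    finally show ?thesis by simp
  qed
  have "wnorm2 M v = (\<Sum>a\<in>UNIV. \<Sum>b\<in>UNIV. v $ a * (M $ a $ b * v $ b))"
    by (simp add: wnorm2_def inner_vec_def matrix_vector_mult_def sum_distrib_left)
  also have "\<dots> \<le> (\<Sum>a\<in>UNIV. \<Sum>b\<in>UNIV.
      (v $ b * v $ b * M $ a $ a + v $ a * v $ a * M $ b $ b) / 2)"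
    by (intro sum_mono entry)
  also have "\<dots> = trace M * (v \<bullet> v)"
    by (simp add: add_divide_distrib sum.distrib trace_def inner_vec_def
        flip: sum_divide_distrib sum_distrib_left sum_distrib_right)
  finally show ?thesis .
qed

lemma transpose_diag_mat: "transpose (diag_mat p) = diag_mat p"
  by (auto simp: transpose_def diag_mat_def vec_eq_iff)

lemma diag_mat_mult_vec: "(diag_mat p *v x) $ j = p $ j * x $ j"
  by (simp add: diag_mat_def matrix_vector_mult_def if_distrib[where f="\<lambda>a. a * _"] cong: if_cong)

lemma matrix_inv_eqI:
  fixes A B :: "'a::semiring_1^'n^'n"
  assumes "A ** B = mat 1" "B ** A = mat 1"
  shows "matrix_inv A = B"
proof -
  have "A ** matrix_inv A = mat 1 \<and> matrix_inv A ** A = mat 1"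
    unfolding matrix_inv_def by (rule someI[of _ B]) (simp add: assms)
  then show ?thesis
    by (metis assms(2) matrix_mul_assoc matrix_mul_lid matrix_mul_rid)
qed

lemma matrix_inv_diag_mat:
  fixes p :: "real^'n"
  assumes "\<And>j. p $ j \<noteq> 0"
  shows "matrix_inv (diag_mat p) = diag_mat (\<chi> j. 1 / p $ j)"
proof (rule matrix_inv_eqI)
  show "diag_mat p ** diag_mat (\<chi> j. 1 / p $ j) = mat 1"
    by (simp add: matrix_eq vec_eq_iff diag_mat_mult_vec assms flip: matrix_vector_mul_assoc)
  show "diag_mat (\<chi> j. 1 / p $ j) ** diag_mat p = mat 1"
    by (simp add: matrix_eq vec_eq_iff diag_mat_mult_vec assms flip: matrix_vector_mul_assoc)
qed

lemma wnorm2_diag_mat: "wnorm2 (diag_mat p) x = (\<Sum>j\<in>UNIV. p $ j * (x $ j)\<^sup>2)"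
  by (simp add: wnorm2_def inner_vec_def diag_mat_mult_vec power2_eq_square ac_simps)

section \<open>Smoothness and strong convexity\<close>

text \<open>Both inequalities at the pair \<open>e\<^sub>j, 0\<close> squeeze the same increment of \<open>f\<close>.\<close>

lemma strong_convexity_le_diag:
  fixes f :: "real^'n \<Rightarrow> real"
  assumes "M_smooth M f" "strongly_convex \<mu> f"
  shows "\<mu> \<le> M $ j $ j"
proof -
  have "f (axis j 1) \<le> f 0 + grad f 0 \<bullet> (axis j 1 - 0) + 1/2 * wnorm2 M (axis j 1 - 0)"
    using assms(1) unfolding M_smooth_def by blast
  moreover have "f (axis j 1) \<ge> f 0 + grad f 0 \<bullet> (axis j 1 - 0) + \<mu>/2 * (norm (axis j 1 - 0 :: real^'n))\<^sup>2"
    using assms(2) unfolding strongly_convex_def by blast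
  ultimately show ?thesis
    by (simp add: wnorm2_axis)
qed

text \<open>The Polyak-Lojasiewicz inequality: \<open>grad f x \<bullet> v + \<mu>/2 |v|\<^sup>2\<close> is at least
  \<open>- |grad f x|\<^sup>2 / (2 \<mu>)\<close>, by completing the square.\<close>

lemma strongly_convex_suboptimality:
  fixes f :: "real^'n \<Rightarrow> real"
  assumes "strongly_convex \<mu> f" "\<mu> > 0"
  shows "2 * \<mu> * (f x - f y) \<le> grad f x \<bullet> grad f x"
proof -
  let ?G = "grad f x" and ?v = "y - x"
  have "f y \<ge> f x + ?G \<bullet> ?v + \<mu>/2 * (?v \<bullet> ?v)"
    using assms(1) unfolding strongly_convex_def by (simp add: power2_norm_eq_inner)
  then have "2 * \<mu> * (f x + ?G \<bullet> ?v + \<mu>/2 * (?v \<bullet> ?v)) \<le> 2 * \<mu> * f y"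
    using assms(2) by (intro mult_left_mono) auto
  then have "2 * \<mu> * (f x - f y) \<le> - 2 * \<mu> * (?G \<bullet> ?v) - \<mu> * \<mu> * (?v \<bullet> ?v)"
    by (simp add: algebra_simps)
  also have "\<dots> = ?G \<bullet> ?G - (?G + \<mu> *\<^sub>R ?v) \<bullet> (?G + \<mu> *\<^sub>R ?v)"
    by (simp add: inner_add_left inner_add_right inner_commute algebra_simps)
  finally show ?thesis
    using inner_ge_zero[of "?G + \<mu> *\<^sub>R ?v"] by linarith
qed

lemma M_smooth_gradient_step:
  assumes "M_smooth M f"
  shows "f (x - \<alpha> *\<^sub>R g) \<le> f x - \<alpha> * (grad f x \<bullet> g) + \<alpha>\<^sup>2 / 2 * wnorm2 M g"
proof -
  have "f (x - \<alpha> *\<^sub>R g) \<le> f x + grad f x \<bullet> (x - \<alpha> *\<^sub>R g - x) + 1/2 * wnorm2 M (x - \<alpha> *\<^sub>R g - x)"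
    using assms unfolding M_smooth_def by blast
  then show ?thesis
    by (simp add: wnorm2_uminus wnorm2_scaleR)
qed

section \<open>Expected decrease in one step\<close>

lemma coordinate_estimator_mean:
  fixes p d h u :: "real^'n"
  assumes "\<And>j. p $ j \<noteq> 0" "(\<Sum>j\<in>UNIV. p $ j) = 1"
  shows "(\<Sum>j\<in>UNIV. p $ j * (u \<bullet> (h + (d $ j / p $ j) *\<^sub>R axis j 1))) = u \<bullet> (h + d)"
proof -
  have "p $ j * (u \<bullet> (h + (d $ j / p $ j) *\<^sub>R axis j 1)) = p $ j * (u \<bullet> h) + u $ j * d $ j" for j
    using assms(1)[of j] by (simp add: inner_add_right inner_axis algebra_simps)
  then have "(\<Sum>j\<in>UNIV. p $ j * (u \<bullet> (h + (d $ j / p $ j) *\<^sub>R axis j 1)))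
      = u \<bullet> h + (\<Sum>j\<in>UNIV. u $ j * d $ j)"
    by (simp add: sum.distrib assms(2) flip: sum_distrib_right)
  then show ?thesis
    by (simp add: inner_add_right) (simp add: inner_vec_def)
qed

text \<open>The estimator has mean \<open>h + d\<close> and its random part has mean \<open>d\<close>, so this is the
  decomposition of a second moment into squared mean and variance. The probabilities
  proportional to \<open>M\<^sub>j\<^sub>j\<close> turn the second moment \<open>\<Sum>\<^sub>j d\<^sub>j\<^sup>2 M\<^sub>j\<^sub>j / p\<^sub>j\<close> of the random
  part into \<open>T |d|\<^sup>2\<close>.\<close>

lemma coordinate_estimator_second_moment:
  fixes M :: "real^'n^'n" and p d h :: "real^'n"
  assumes "transpose M = M" "\<And>j. p $ j \<noteq> 0" "(\<Sum>j\<in>UNIV. p $ j) = 1"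
    and diag: "\<And>j. M $ j $ j = T * p $ j"
  shows "(\<Sum>j\<in>UNIV. p $ j * wnorm2 M (h + (d $ j / p $ j) *\<^sub>R axis j 1))
       = wnorm2 M (h + d) - wnorm2 M d + T * (d \<bullet> d)"
proof -
  have "p $ j * wnorm2 M (h + (d $ j / p $ j) *\<^sub>R axis j 1)
      = p $ j * wnorm2 M h + 2 * (d $ j * (M *v h) $ j) + T * (d $ j * d $ j)" for j
    using assms(2)[of j]
    by (simp add: wnorm2_add_axis[OF assms(1)] diag field_simps power2_eq_square)
  then have "(\<Sum>j\<in>UNIV. p $ j * wnorm2 M (h + (d $ j / p $ j) *\<^sub>R axis j 1))
      = wnorm2 M h + 2 * (d \<bullet> (M *v h)) + T * (d \<bullet> d)"
    by (simp add: sum.distrib inner_vec_def assms(3) flip: sum_distrib_right sum_distrib_left)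
  then show ?thesis
    by (simp add: wnorm2_add[OF assms(1)])
qed

text \<open>Replacing \<open>h\<^sub>j\<close> by \<open>u\<^sub>j\<close> changes the weighted norm by \<open>(u\<^sub>j\<^sup>2 - h\<^sub>j\<^sup>2) / p\<^sub>j\<close>, and the
  mean over \<open>j\<close> cancels the weight.\<close>

lemma coordinate_update_mean_weighted_norm:
  fixes p h u :: "real^'n"
  assumes "\<And>j. p $ j \<noteq> 0" "(\<Sum>j\<in>UNIV. p $ j) = 1"
  shows "(\<Sum>j\<in>UNIV. p $ j * wnorm2 (matrix_inv (diag_mat p)) (h + (u - h) $ j *\<^sub>R axis j 1))
       = wnorm2 (matrix_inv (diag_mat p)) h + u \<bullet> u - h \<bullet> h"
proof -
  let ?D = "matrix_inv (diag_mat p)"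
  have D: "?D = diag_mat (\<chi> j. 1 / p $ j)"
    by (rule matrix_inv_diag_mat) (rule assms(1))
  have "p $ j * wnorm2 ?D (h + (u - h) $ j *\<^sub>R axis j 1)
      = p $ j * wnorm2 ?D h + (u $ j * u $ j - h $ j * h $ j)" for j
    using assms(1)[of j] unfolding D wnorm2_add_axis[OF transpose_diag_mat]
    by (simp add: diag_mat_mult_vec) (simp add: diag_mat_def field_simps power2_eq_square)
  then show ?thesis
    by (simp add: sum.distrib sum_subtractf inner_vec_def assms(2) flip: sum_distrib_right)
qed

lemma weighted_norm_le:
  fixes p h :: "real^'n"
  assumes "\<And>j. p $ j > 0" "\<And>j. c \<le> p $ j"
  shows "c * wnorm2 (matrix_inv (diag_mat p)) h \<le> h \<bullet> h"
proof -
  have D: "matrix_inv (diag_mat p) = diag_mat (\<chi> j. 1 / p $ j)"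
    by (rule matrix_inv_diag_mat) (metis assms(1) less_irrefl)
  have "c * (1 / p $ j * (h $ j)\<^sup>2) \<le> h $ j * h $ j" for j
  proof -
    have "c / p $ j * (h $ j)\<^sup>2 \<le> 1 * (h $ j)\<^sup>2"
      using assms[of j] by (intro mult_right_mono) auto
    then show ?thesis by (simp add: power2_eq_square)
  qed
  then show ?thesis
    unfolding D wnorm2_diag_mat sum_distrib_left inner_vec_def
    by (intro sum_mono) simp
qed

lemma sega_step_eq:
  "sega_step f p \<alpha> j (x, h) =
     (x - \<alpha> *\<^sub>R (h + ((grad f x - h) $ j / p $ j) *\<^sub>R axis j 1), h + (grad f x - h) $ j *\<^sub>R axis j 1)"
  by (simp add: sega_step_def Let_def inner_axis')

text \<open>The gradient coefficient collects a gain \<open>\<alpha>\<close> from the unbiased step, a loss \<open>\<sigma>\<close> because \<open>h\<close>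
  moves towards the gradient, and a loss \<open>3 \<alpha>\<^sup>2 T / 2\<close> from the second moment of the estimator; \<open>h\<close>
  gains \<open>\<sigma>\<close> by being overwritten and loses \<open>\<alpha>\<^sup>2 T\<close> to the same second moment. This is the
  trade-off that the choice of \<open>\<alpha>\<close> and \<open>\<sigma>\<close> has to balance.\<close>

lemma sega_expected_decrease:
  fixes f :: "real^'n \<Rightarrow> real" and M :: "real^'n^'n" and p h :: "real^'n"
  defines "T \<equiv> trace M"
  assumes M: "pos_def M" and smooth: "M_smooth M f"
    and p: "\<And>j. p $ j = M $ j $ j / T"
  shows "(\<Sum>j\<in>UNIV. p $ j * sega_lyapunov f xstar p \<sigma> (sega_step f p \<alpha> j (x, h)))
    \<le> sega_lyapunov f xstar p \<sigma> (x, h)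
      - (\<alpha> - \<sigma> - 3 / 2 * \<alpha>\<^sup>2 * T) * (grad f x \<bullet> grad f x) - (\<sigma> - \<alpha>\<^sup>2 * T) * (h \<bullet> h)"
proof -
  define G where "G = grad f x"
  define d where "d = G - h"
  define g where "g = (\<lambda>j. h + (d $ j / p $ j) *\<^sub>R axis j 1)"
  let ?D = "matrix_inv (diag_mat p)"
  have T: "T > 0"
    unfolding T_def by (rule pos_def_trace_pos[OF M])
  have sym: "transpose M = M"
    using M by (simp add: pos_def_def)
  have p_pos: "p $ j > 0" for j
    using pos_def_diag_pos[OF M] T by (simp add: p)
  then have p_nz: "p $ j \<noteq> 0" for j
    by (metis less_irrefl)
  have p_sum: "(\<Sum>j\<in>UNIV. p $ j) = 1"
    using T by (simp add: p T_def trace_def flip: sum_divide_distrib)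
  have diag: "M $ j $ j = T * p $ j" for j
    using T by (simp add: p)
  have hd: "h + d = G" by (simp add: d_def)
  have second_moment: "(\<Sum>j\<in>UNIV. p $ j * wnorm2 M (g j)) \<le> 3 * T * (G \<bullet> G) + 2 * T * (h \<bullet> h)"
  proof -
    have "(\<Sum>j\<in>UNIV. p $ j * wnorm2 M (g j)) = wnorm2 M G - wnorm2 M d + T * (d \<bullet> d)"
      unfolding g_def hd[symmetric]
      by (rule coordinate_estimator_second_moment[OF sym p_nz p_sum diag])
    also have "\<dots> \<le> T * (G \<bullet> G) + T * (d \<bullet> d)"
      using pos_def_wnorm2_le_trace[OF M, of G] pos_def_wnorm2_nonneg[OF M, of d]
      by (simp add: T_def)
    \<comment> \<open>the parallelogram law, \<open>|G - h|\<^sup>2 + |G + h|\<^sup>2 = 2 |G|\<^sup>2 + 2 |h|\<^sup>2\<close>\<close>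
    also have "T * (d \<bullet> d) \<le> T * (2 * (G \<bullet> G) + 2 * (h \<bullet> h))"
      using T inner_ge_zero[of "G + h"]
      by (intro mult_left_mono)
        (auto simp: d_def inner_add_left inner_add_right inner_diff_left inner_diff_right inner_commute)
    finally show ?thesis by (simp add: algebra_simps)
  qed
  have "(\<Sum>j\<in>UNIV. p $ j * sega_lyapunov f xstar p \<sigma> (sega_step f p \<alpha> j (x, h)))
      = (\<Sum>j\<in>UNIV. p $ j * (f (x - \<alpha> *\<^sub>R g j) - f xstar + \<sigma> * wnorm2 ?D (h + d $ j *\<^sub>R axis j 1)))"
    by (simp add: sega_step_eq sega_lyapunov_def g_def d_def G_def)
  also have "\<dots> \<le> (\<Sum>j\<in>UNIV. p $ j * ((f x - \<alpha> * (G \<bullet> g j) + \<alpha>\<^sup>2 / 2 * wnorm2 M (g j)) - f xstar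
      + \<sigma> * wnorm2 ?D (h + d $ j *\<^sub>R axis j 1)))"
    unfolding G_def
    by (intro sum_mono mult_left_mono add_mono diff_mono M_smooth_gradient_step[OF smooth] order_refl
        less_imp_le[OF p_pos])
  also have "\<dots> = (\<Sum>j\<in>UNIV. p $ j * (f x - f xstar)) - \<alpha> * (\<Sum>j\<in>UNIV. p $ j * (G \<bullet> g j))
      + \<alpha>\<^sup>2 / 2 * (\<Sum>j\<in>UNIV. p $ j * wnorm2 M (g j))
      + \<sigma> * (\<Sum>j\<in>UNIV. p $ j * wnorm2 ?D (h + d $ j *\<^sub>R axis j 1))"
    unfolding sum_distrib_left sum.distrib[symmetric] sum_subtractf[symmetric]
    by (intro sum.cong refl) (simp add: algebra_simps)
  also have "(\<Sum>j\<in>UNIV. p $ j * (f x - f xstar)) = f x - f xstar"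
    by (simp add: p_sum flip: sum_distrib_right)
  also have "(\<Sum>j\<in>UNIV. p $ j * (G \<bullet> g j)) = G \<bullet> G"
    unfolding g_def coordinate_estimator_mean[OF p_nz p_sum] hd ..
  also have "(\<Sum>j\<in>UNIV. p $ j * wnorm2 ?D (h + d $ j *\<^sub>R axis j 1)) = wnorm2 ?D h + G \<bullet> G - h \<bullet> h"
    unfolding d_def by (rule coordinate_update_mean_weighted_norm[OF p_nz p_sum])
  finally have "(\<Sum>j\<in>UNIV. p $ j * sega_lyapunov f xstar p \<sigma> (sega_step f p \<alpha> j (x, h)))
      \<le> f x - f xstar - \<alpha> * (G \<bullet> G) + \<alpha>\<^sup>2 / 2 * (\<Sum>j\<in>UNIV. p $ j * wnorm2 M (g j))
        + \<sigma> * (wnorm2 ?D h + G \<bullet> G - h \<bullet> h)" .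
  also have "\<dots> \<le> f x - f xstar - \<alpha> * (G \<bullet> G) + \<alpha>\<^sup>2 / 2 * (3 * T * (G \<bullet> G) + 2 * T * (h \<bullet> h))
        + \<sigma> * (wnorm2 ?D h + G \<bullet> G - h \<bullet> h)"
    by (intro add_mono diff_mono mult_left_mono second_moment order_refl) auto
  finally show ?thesis
    by (simp add: sega_lyapunov_def G_def algebra_simps)
qed

text \<open>With \<open>a = \<alpha> T = 0.232\<close> and \<open>s = \<sigma> T = 0.061\<close> the expected decrease is at least
  \<open>((a - s - 3 a\<^sup>2 / 2) |grad f x|\<^sup>2 + (s - a\<^sup>2) |h|\<^sup>2) / T\<close>. Strong convexity makes the first term pay
  for the share \<open>0.117 \<mu> / T\<close> of \<open>f x - f xstar\<close>, which needs
  \<open>a - s - 3 a\<^sup>2 / 2 \<ge> 0.117 / 2\<close>, and \<open>\<mu> / T \<le> p\<^sub>j\<close> makes the second term pay for that share of the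
  weighted norm, which needs \<open>s - a\<^sup>2 \<ge> 0.117 s\<close>. The second requirement is almost tight:
  \<open>s - a\<^sup>2 = 0.007176\<close> and \<open>0.117 s = 0.007137\<close>.\<close>

lemma sega_expected_contraction:
  fixes f :: "real^'n \<Rightarrow> real" and M :: "real^'n^'n" and p h :: "real^'n"
  defines "T \<equiv> trace M"
  assumes M: "pos_def M" and smooth: "M_smooth M f" and mu: "\<mu> > 0"
    and convex: "strongly_convex \<mu> f"
    and p: "\<And>j. p $ j = M $ j $ j / T"
    and alpha: "\<alpha> = 0.232 / T" and sigma: "\<sigma> = 0.061 / T"
  shows "(\<Sum>j\<in>UNIV. p $ j * sega_lyapunov f xstar p \<sigma> (sega_step f p \<alpha> j (x, h)))
    \<le> (1 - 0.117 * \<mu> / T) * sega_lyapunov f xstar p \<sigma> (x, h)"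
proof -
  let ?D = "matrix_inv (diag_mat p)"
  define G2 where "G2 = grad f x \<bullet> grad f x"
  define h2 where "h2 = h \<bullet> h"
  define W where "W = wnorm2 ?D h"
  have T: "T > 0"
    unfolding T_def by (rule pos_def_trace_pos[OF M])
  have nonneg: "G2 \<ge> 0" "h2 \<ge> 0"
    by (simp_all add: G2_def h2_def)
  have W_le: "\<mu> / T * W \<le> h2"
    unfolding W_def h2_def
  proof (rule weighted_norm_le)
    show "p $ j > 0" for j
      using pos_def_diag_pos[OF M] T by (simp add: p)
    show "\<mu> / T \<le> p $ j" for j
      using strong_convexity_le_diag[OF smooth convex] T by (simp add: p divide_right_mono)
  qed
  have norm_share: "0.117 * \<mu> / T * (\<sigma> * W) \<le> (\<sigma> - \<alpha>\<^sup>2 * T) * h2"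
  proof -
    have "0.117 * 0.061 / T * (\<mu> / T * W) \<le> 0.117 * 0.061 / T * h2"
      using T W_le by (intro mult_left_mono) auto
    also have "\<dots> \<le> (0.061 - 0.232\<^sup>2) / T * h2"
      using T nonneg by (intro mult_right_mono divide_right_mono) (auto simp: power2_eq_square)
    also have "\<dots> = (\<sigma> - \<alpha>\<^sup>2 * T) * h2"
      using T by (simp add: alpha sigma field_simps power2_eq_square)
    finally show ?thesis
      by (simp add: sigma)
  qed
  have value_share: "0.117 * \<mu> / T * (f x - f xstar) \<le> (\<alpha> - \<sigma> - 3 / 2 * \<alpha>\<^sup>2 * T) * G2"
  proof -
    have "0.117 / 2 / T * (2 * \<mu> * (f x - f xstar)) \<le> 0.117 / 2 / T * G2"
      unfolding G2_def using T
      by (intro mult_left_mono strongly_convex_suboptimality[OF convex mu]) auto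
    also have "\<dots> \<le> (0.232 - 0.061 - 3 / 2 * 0.232\<^sup>2) / T * G2"
      using T nonneg by (intro mult_right_mono divide_right_mono) (auto simp: power2_eq_square)
    also have "\<dots> = (\<alpha> - \<sigma> - 3 / 2 * \<alpha>\<^sup>2 * T) * G2"
      using T by (simp add: alpha sigma field_simps power2_eq_square)
    finally show ?thesis
      by simp
  qed
  have "(\<Sum>j\<in>UNIV. p $ j * sega_lyapunov f xstar p \<sigma> (sega_step f p \<alpha> j (x, h)))
      \<le> sega_lyapunov f xstar p \<sigma> (x, h) - (\<alpha> - \<sigma> - 3 / 2 * \<alpha>\<^sup>2 * T) * G2 - (\<sigma> - \<alpha>\<^sup>2 * T) * h2"
    using sega_expected_decrease[OF M smooth, of p xstar \<sigma> \<alpha> x h] p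
    by (simp add: T_def G2_def h2_def)
  also have "\<dots> \<le> sega_lyapunov f xstar p \<sigma> (x, h) - 0.117 * \<mu> / T * (f x - f xstar)
      - 0.117 * \<mu> / T * (\<sigma> * W)"
    using norm_share value_share by linarith
  also have "\<dots> = (1 - 0.117 * \<mu> / T) * sega_lyapunov f xstar p \<sigma> (x, h)"
    by (simp add: sega_lyapunov_def W_def left_diff_distrib distrib_left)
  finally show ?thesis .
qed

section \<open>Averaging over the next draw\<close>

definition depends_on_first :: "nat \<Rightarrow> ((nat \<Rightarrow> 'b) \<Rightarrow> 'c) \<Rightarrow> bool" where
  "depends_on_first k F \<longleftrightarrow> (\<forall>u v. (\<forall>t<k. u t = v t) \<longrightarrow> F u = F v)"

lemma depends_on_first_restrict:
  "depends_on_first k F \<Longrightarrow> F u = F (restrict u {..<k})"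
  by (auto simp: depends_on_first_def)

lemma depends_on_first_compose:
  "depends_on_first k F \<Longrightarrow> depends_on_first k (\<lambda>u. g (F u))"
  unfolding depends_on_first_def by metis

lemma depends_on_first_sega: "depends_on_first k (\<lambda>u. sega f p \<alpha> x0 h0 u k)"
proof -
  have "\<forall>t<k. u t = v t \<Longrightarrow> sega f p \<alpha> x0 h0 u k = sega f p \<alpha> x0 h0 v k" for u v
    by (induction k) auto
  then show ?thesis by (auto simp: depends_on_first_def)
qed

lemma measurable_PiM_finite_draws:
  fixes F :: "(nat \<Rightarrow> 'b::finite) \<Rightarrow> real"
  shows "F \<in> borel_measurable (PiM {..<k} (\<lambda>_. count_space UNIV))"
  by (subst count_space_PiM_finite) (auto intro: countable_finite)

context prob_space
begin

text \<open>Finitely many draws from a finite set have finitely many outcomes, so the integrand is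
  measurable and bounded.\<close>

lemma integrable_finite_draws:
  fixes i :: "nat \<Rightarrow> 'a \<Rightarrow> 'b::finite" and F :: "(nat \<Rightarrow> 'b) \<Rightarrow> real"
  assumes rv: "\<And>t. i t \<in> measurable M (count_space UNIV)" and F: "depends_on_first k F"
  shows "integrable M (\<lambda>\<omega>. F (\<lambda>t. i t \<omega>))"
proof -
  let ?S = "PiE {..<k} (\<lambda>_. UNIV :: 'b set)"
  have eq: "F (\<lambda>t. i t \<omega>) = F (\<lambda>t\<in>{..<k}. i t \<omega>)" for \<omega>
    by (rule depends_on_first_restrict[OF F])
  have "(\<lambda>\<omega>. \<lambda>t\<in>{..<k}. i t \<omega>) \<in> measurable M (PiM {..<k} (\<lambda>_. count_space UNIV))"
    by (intro measurable_restrict rv)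
  then have meas: "(\<lambda>\<omega>. F (\<lambda>t\<in>{..<k}. i t \<omega>)) \<in> borel_measurable M"
    by (rule measurable_compose[OF _ measurable_PiM_finite_draws])
  have fin: "finite ?S"
    by (intro finite_PiE) auto
  have "norm (F (\<lambda>t\<in>{..<k}. i t \<omega>)) \<le> (\<Sum>u\<in>?S. norm (F u))" for \<omega>
    using fin by (intro member_le_sum[where f = "\<lambda>u. norm (F u)"]) auto
  then show ?thesis
    unfolding eq by (intro integrable_const_bound[OF _ meas]) auto
qed

text \<open>The draw \<open>i k\<close> is independent of \<open>i 0, \<dots>, i (k - 1)\<close>. Splitting according to the value of \<open>i k\<close>
  therefore gives one product of an indicator with a function of the past for each value.\<close>

lemma expectation_next_draw:
  fixes i :: "nat \<Rightarrow> 'a \<Rightarrow> 'b::finite" and F :: "'b \<Rightarrow> (nat \<Rightarrow> 'b) \<Rightarrow> real"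
  assumes indep: "indep_vars (\<lambda>_. count_space UNIV) i UNIV"
    and F: "\<And>j. depends_on_first k (F j)"
  shows "expectation (\<lambda>\<omega>. F (i k \<omega>) (\<lambda>t. i t \<omega>))
    = expectation (\<lambda>\<omega>. \<Sum>j\<in>UNIV. prob {\<omega> \<in> space M. i k \<omega> = j} * F j (\<lambda>t. i t \<omega>))"
proof -
  have rv: "i t \<in> measurable M (count_space UNIV)" for t
    using indep by (simp add: indep_vars_def)
  have int: "integrable M (\<lambda>\<omega>. F j (\<lambda>t. i t \<omega>))" for j
    by (rule integrable_finite_draws[OF rv F])
  have ind_int: "integrable M (\<lambda>\<omega>. indicator {j} (i k \<omega>) :: real)" for j
    using integrable_finite_draws[OF rv, of "Suc k" "\<lambda>u. indicator {j} (u k)"]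
    by (simp add: depends_on_first_def)
  have ind_exp: "expectation (\<lambda>\<omega>. indicator {j} (i k \<omega>) :: real) = prob {\<omega> \<in> space M. i k \<omega> = j}" for j
  proof -
    have "expectation (\<lambda>\<omega>. indicator {j} (i k \<omega>) :: real)
        = expectation (indicator {\<omega> \<in> space M. i k \<omega> = j})"
      by (intro Bochner_Integration.integral_cong) (auto simp: indicator_def)
    moreover have "{\<omega> \<in> space M. i k \<omega> = j} \<inter> space M = {\<omega> \<in> space M. i k \<omega> = j}"
      by auto
    ultimately show ?thesis
      by simp
  qed
  have indep_past: "indep_var borel (\<lambda>\<omega>. indicator {j} (i k \<omega>) :: real) borel (\<lambda>\<omega>. F j (\<lambda>t. i t \<omega>))" for j
  proof -
    have "indep_var (PiM {k} (\<lambda>_. count_space UNIV)) (\<lambda>\<omega>. \<lambda>t\<in>{k}. i t \<omega>)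
        (PiM {..<k} (\<lambda>_. count_space UNIV)) (\<lambda>\<omega>. \<lambda>t\<in>{..<k}. i t \<omega>)"
      by (rule indep_var_restrict[OF indep]) auto
    moreover have "(\<lambda>u. indicator {j} (u k) :: real) \<in> borel_measurable (PiM {k} (\<lambda>_. count_space UNIV))"
      by (rule measurable_compose[OF measurable_component_singleton]) auto
    ultimately have "indep_var borel ((\<lambda>u. indicator {j} (u k) :: real) \<circ> (\<lambda>\<omega>. \<lambda>t\<in>{k}. i t \<omega>))
        borel (F j \<circ> (\<lambda>\<omega>. \<lambda>t\<in>{..<k}. i t \<omega>))"
      using measurable_PiM_finite_draws by (rule indep_var_compose)
    then show ?thesis
      by (simp add: comp_def flip: depends_on_first_restrict[OF F])
  qed
  have split: "F (i k \<omega>) (\<lambda>t. i t \<omega>) = (\<Sum>j\<in>UNIV. indicator {j} (i k \<omega>) * F j (\<lambda>t. i t \<omega>))" for \<omega>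
    by (simp add: indicator_def if_distrib[where f = "\<lambda>a. a * _"] cong: if_cong)
  have "expectation (\<lambda>\<omega>. F (i k \<omega>) (\<lambda>t. i t \<omega>))
      = (\<Sum>j\<in>UNIV. expectation (\<lambda>\<omega>. indicator {j} (i k \<omega>) * F j (\<lambda>t. i t \<omega>)))"
    unfolding split
    by (intro Bochner_Integration.integral_sum indep_var_integrable[OF indep_past ind_int int])
  also have "\<dots> = (\<Sum>j\<in>UNIV. expectation (\<lambda>\<omega>. prob {\<omega> \<in> space M. i k \<omega> = j} * F j (\<lambda>t. i t \<omega>)))"
    by (simp add: indep_var_lebesgue_integral[OF indep_past ind_int int] ind_exp)
  also have "\<dots> = expectation (\<lambda>\<omega>. \<Sum>j\<in>UNIV. prob {\<omega> \<in> space M. i k \<omega> = j} * F j (\<lambda>t. i t \<omega>))"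
    by (intro Bochner_Integration.integral_sum[symmetric] integrable_mult_right int)
  finally show ?thesis .
qed

end

section \<open>Linear convergence of SEGA\<close>

theorem corollary4p3:
  fixes f :: "real^'n \<Rightarrow> real"
    and M :: "real^'n^'n"
    and p xstar x0 h0 :: "real^'n"
    and \<mu> \<alpha> \<sigma> :: real
    and \<Omega> :: "'w measure"
    and i :: "nat \<Rightarrow> 'w \<Rightarrow> 'n"
    and k :: nat
  assumes M_pos: "pos_def M"
    and smooth: "M_smooth M f"
    and mu_pos: "\<mu> > 0"
    and convex: "strongly_convex \<mu> f"
    and minimizer: "\<forall>x. f xstar \<le> f x"
    and p: "\<forall>j. p $ j = M $ j $ j / trace M"
    and prob: "prob_space \<Omega>"
    and indep: "prob_space.indep_vars \<Omega> (\<lambda>_. count_space UNIV) i UNIV"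
    and distr: "\<forall>t j. measure \<Omega> {\<omega> \<in> space \<Omega>. i t \<omega> = j} = p $ j"
    and alpha: "\<alpha> = 0.232 / trace M"
    and sigma: "\<sigma> = 0.061 / trace M"
  shows "(\<integral>\<omega>. sega_lyapunov f xstar p \<sigma> (sega f p \<alpha> x0 h0 (\<lambda>t. i t \<omega>) k) \<partial>\<Omega>)
           \<le> (1 - 0.117 * \<mu> / trace M) ^ k * sega_lyapunov f xstar p \<sigma> (x0, h0)"
proof -
  interpret prob_space \<Omega> by (rule prob)
  let ?\<Psi> = "sega_lyapunov f xstar p \<sigma>"
  let ?S = "sega f p \<alpha> x0 h0"
  let ?\<rho> = "1 - 0.117 * \<mu> / trace M"
  have rv: "i t \<in> measurable \<Omega> (count_space UNIV)" for t
    using indep by (simp add: indep_vars_def)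
  have int: "integrable \<Omega> (\<lambda>\<omega>. g (?S (\<lambda>t. i t \<omega>) k))" for g :: "_ \<Rightarrow> real" and k
    by (rule integrable_finite_draws[OF rv depends_on_first_compose[OF depends_on_first_sega]])
  have contraction: "(\<Sum>j\<in>UNIV. p $ j * ?\<Psi> (sega_step f p \<alpha> j s)) \<le> ?\<rho> * ?\<Psi> s" for s
    using sega_expected_contraction[OF M_pos smooth mu_pos convex _ alpha sigma] p
    by (cases s) auto
  have rho: "0 \<le> ?\<rho>"
  proof -
    have "\<mu> \<le> trace M"
      using strong_convexity_le_diag[OF smooth convex] pos_def_diag_le_trace[OF M_pos]
      by (rule order_trans)
    then show ?thesis
      using pos_def_trace_pos[OF M_pos] mu_pos by (simp add: field_simps)
  qed
  show ?thesis
  proof (induction k)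
    case 0
    show ?case by (simp add: prob_space)
  next
    case (Suc k)
    have "(\<integral>\<omega>. ?\<Psi> (?S (\<lambda>t. i t \<omega>) (Suc k)) \<partial>\<Omega>)
        = (\<integral>\<omega>. (\<Sum>j\<in>UNIV. p $ j * ?\<Psi> (sega_step f p \<alpha> j (?S (\<lambda>t. i t \<omega>) k))) \<partial>\<Omega>)"
      using expectation_next_draw[OF indep, where k = k
          and F = "\<lambda>j u. ?\<Psi> (sega_step f p \<alpha> j (?S u k))",
          OF depends_on_first_compose[OF depends_on_first_sega]] distr
      by simp
    also have "\<dots> \<le> (\<integral>\<omega>. ?\<rho> * ?\<Psi> (?S (\<lambda>t. i t \<omega>) k) \<partial>\<Omega>)"
      by (intro integral_mono int contraction)
    also have "\<dots> = ?\<rho> * (\<integral>\<omega>. ?\<Psi> (?S (\<lambda>t. i t \<omega>) k) \<partial>\<Omega>)"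
      by simp
    also have "\<dots> \<le> ?\<rho> * (?\<rho> ^ k * ?\<Psi> (x0, h0))"
      by (intro mult_left_mono Suc.IH rho)
    finally show ?case
      by (simp add: mult.assoc)
  qed
qed

end
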